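(* For every $\mathcal{L}_2$-formula $A$, the following are equivalent: (1) $\mathbf{GR}^\bullet\vdash A$; (2) $\mathbf{GR}\vdash A$; (3) $A$ is valid on all non-trivial $\mathbf{GR}^\circ$-frames; (4) $A$ is valid on all $\blacksquare$-serial $\mathbf{GR}^\circ$-frames.
   Context: $\mathcal{L}_2$ is the bimodal propositional language with countably many propositional variables, $\bot$, connectives $\neg,\vee$ (others defined), and unary modal operators $\Box,\blacksquare$; $\Diamond$ abbreviates $\neg\Box\neg$; $\mathrm{MF}_2$ is the set of all $\mathcal{L}_2$-formulas. The logic $\mathbf{GR}^-$ has as axioms all propositional tautologies of $\mathcal{L}_2$ and all instances of $\Box(A\to B)\to(\Box A\to\Box B)$, $\Box(\Box A\to A)\to\Box A$, $\blacksquare A\to\Box A$, $\Box A\to\Box\blacksquare A$, $\Box A\to(\Box\bot\vee\blacksquare A)$, $\Diamond\blacksquare A\to\Diamond A$, and rules modus ponens and $\Box$-necessitation. $\mathbf{GR}$ is $\mathbf{GR}^-$ plus the rule: from $\Box A$ infer $A$. $\mathbf{GR}^\circ$ is $\mathbf{GR}^-$ plus the rule: from $A$ infer $\blacksquare A$; $\mathbf{GR}^\bullet$ is $\mathbf{GR}^\circ$ plus the rule: from $\neg A$ infer $\neg\blacksquare A$. A $\mathbf{GR}^\circ$-frame is a triple $(W,\sqsubset,\{\prec_B\}_{B\in\mathrm{MF}_2})$ where $W\neq\emptyset$, $\sqsubset$ is a transitive and conversely well-founded binary relation on $W$, and each $\prec_B$ is a binary relation on $W$ such that for all $x,y,z\in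 W$: (i) $x\sqsubset y\Rightarrow x\prec_B y$; (ii) $x\sqsubset y$ and $y\prec_B z$ imply $x\sqsubset z$; (iii) $x\prec_B y$ and $x\sqsubset z$ imply $x\sqsubset y$; (iv) if $x\sqsubset y$ then there is $z$ with $y\prec_B z$ and $x\sqsubset z$. Models on such frames: usual clauses for connectives, $w\Vdash\Box B$ iff all $\sqsubset$-successors of $w$ satisfy $B$, $w\Vdash\blacksquare B$ iff all $\prec_B$-successors of $w$ satisfy $B$; validity on a frame means truth at all worlds of all models on it. The frame is non-trivial if there exist $r,w\in W$ with $r$ the root with respect to $\sqsubset$ (i.e. $r\sqsubset x$ for every $x\ne r$) and $r\neq w$. It is $\blacksquare$-serial if for every $B\in\mathrm{MF}_2$ and $x\in W$ there is $y$ with $x\prec_B y$. *)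

theory Defs
  imports Main
begin

datatype fm =
    Var nat
  | Bot
  | Neg fm
  | Or fm fm
  | Box fm
  | BBox fm

abbreviation Imp :: "fm \<Rightarrow> fm \<Rightarrow> fm" where
  "Imp A B \<equiv> Or (Neg A) B"

abbreviation Dia :: "fm \<Rightarrow> fm" where
  "Dia A \<equiv> Neg (Box (Neg A))"

text \<open>Propositional tautologies of the bimodal language: variables and formulas whose
  outermost symbol is a modal operator are treated as atoms.\<close>

fun prop_eval :: "(fm \<Rightarrow> bool) \<Rightarrow> fm \<Rightarrow> bool" where
  "prop_eval v (Var p) = v (Var p)"
| "prop_eval v Bot = False"
| "prop_eval v (Neg A) = (\<not> prop_eval v A)"
| "prop_eval v (Or A B) = (prop_eval v A \<or> prop_eval v B)"
| "prop_eval v (Box A) = v (Box A)"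
| "prop_eval v (BBox A) = v (BBox A)"

definition tautology :: "fm \<Rightarrow> bool" where
  "tautology A \<longleftrightarrow> (\<forall>v. prop_eval v A)"

inductive GR_axiom :: "fm \<Rightarrow> bool" where
  Taut: "tautology A \<Longrightarrow> GR_axiom A"
| K: "GR_axiom (Imp (Box (Imp A B)) (Imp (Box A) (Box B)))"
| Loeb: "GR_axiom (Imp (Box (Imp (Box A) A)) (Box A))"
| BBox_Box: "GR_axiom (Imp (BBox A) (Box A))"
| Box_Box_BBox: "GR_axiom (Imp (Box A) (Box (BBox A)))"
| Box_Bot_BBox: "GR_axiom (Imp (Box A) (Or (Box Bot) (BBox A)))"
| Dia_BBox_Dia: "GR_axiom (Imp (Dia (BBox A)) (Dia A))"

text \<open>Derivability in the base logic extended by one-premise rules, given as a set of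
  (premise, conclusion) pairs; the base logic itself is \<open>derivable {}\<close>.\<close>

inductive derivable :: "(fm \<times> fm) set \<Rightarrow> fm \<Rightarrow> bool" for rules :: "(fm \<times> fm) set" where
  Axiom: "GR_axiom A \<Longrightarrow> derivable rules A"
| MP: "derivable rules (Imp A B) \<Longrightarrow> derivable rules A \<Longrightarrow> derivable rules B"
| Box_Nec: "derivable rules A \<Longrightarrow> derivable rules (Box A)"
| Extra: "(A, B) \<in> rules \<Longrightarrow> derivable rules A \<Longrightarrow> derivable rules B"

definition Box_elim_rule :: "(fm \<times> fm) set" where
  "Box_elim_rule = {(Box A, A) | A. True}"

definition BBox_nec_rule :: "(fm \<times> fm) set" where
  "BBox_nec_rule = {(A, BBox A) | A. True}"

definition Neg_BBox_rule :: "(fm \<times> fm) set" where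
  "Neg_BBox_rule = {(Neg A, Neg (BBox A)) | A. True}"

definition GR :: "fm \<Rightarrow> bool" where
  "GR = derivable Box_elim_rule"

definition GR_bullet :: "fm \<Rightarrow> bool" where
  "GR_bullet = derivable (BBox_nec_rule \<union> Neg_BBox_rule)"

definition GRo_frame :: "'w set \<Rightarrow> 'w rel \<Rightarrow> (fm \<Rightarrow> 'w rel) \<Rightarrow> bool" where
  "GRo_frame W R S \<longleftrightarrow>
     W \<noteq> {} \<and> R \<subseteq> W \<times> W \<and> trans R \<and> wf (R\<inverse>) \<and>
     (\<forall>B. S B \<subseteq> W \<times> W) \<and>
     (\<forall>B. \<forall>x\<in>W. \<forall>y\<in>W. (x, y) \<in> R \<longrightarrow> (x, y) \<in> S B) \<and>
     (\<forall>B. \<forall>x\<in>W. \<forall>y\<in>W. \<forall>z\<in>W. (x, y) \<in> R \<and> (y, z) \<in> S B \<longrightarrow> (x, z) \<in> R) \<and>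
     (\<forall>B. \<forall>x\<in>W. \<forall>y\<in>W. \<forall>z\<in>W. (x, y) \<in> S B \<and> (x, z) \<in> R \<longrightarrow> (x, y) \<in> R) \<and>
     (\<forall>B. \<forall>x\<in>W. \<forall>y\<in>W. (x, y) \<in> R \<longrightarrow> (\<exists>z\<in>W. (y, z) \<in> S B \<and> (x, z) \<in> R))"

fun forces :: "'w rel \<Rightarrow> (fm \<Rightarrow> 'w rel) \<Rightarrow> (nat \<Rightarrow> 'w set) \<Rightarrow> 'w \<Rightarrow> fm \<Rightarrow> bool" where
  "forces R S V w (Var p) = (w \<in> V p)"
| "forces R S V w Bot = False"
| "forces R S V w (Neg A) = (\<not> forces R S V w A)"
| "forces R S V w (Or A B) = (forces R S V w A \<or> forces R S V w B)"
| "forces R S V w (Box A) = (\<forall>v. (w, v) \<in> R \<longrightarrow> forces R S V v A)"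
| "forces R S V w (BBox A) = (\<forall>v. (w, v) \<in> S A \<longrightarrow> forces R S V v A)"

definition valid_on :: "'w set \<Rightarrow> 'w rel \<Rightarrow> (fm \<Rightarrow> 'w rel) \<Rightarrow> fm \<Rightarrow> bool" where
  "valid_on W R S A \<longleftrightarrow> (\<forall>V. (\<forall>p. V p \<subseteq> W) \<longrightarrow> (\<forall>w\<in>W. forces R S V w A))"

definition nontrivial :: "'w set \<Rightarrow> 'w rel \<Rightarrow> bool" where
  "nontrivial W R \<longleftrightarrow>
     (\<exists>r\<in>W. \<exists>w\<in>W. (\<forall>x\<in>W. x \<noteq> r \<longrightarrow> (r, x) \<in> R) \<and> r \<noteq> w)"

definition BBox_serial :: "'w set \<Rightarrow> (fm \<Rightarrow> 'w rel) \<Rightarrow> bool" where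
  "BBox_serial W S \<longleftrightarrow> (\<forall>B. \<forall>x\<in>W. \<exists>y\<in>W. (x, y) \<in> S B)"

end

theory Submission
  imports Defs
begin

text \<open>
  Over \<open>\<box>\<close>-elimination the two rules of the bullet logic are derivable, and every
  non-trivial frame is \<open>\<blacksquare>\<close>-serial, so everything reduces to one completeness
  result: a formula \<open>A\<close> unprovable in the bullet logic fails above the root of a finite
  non-trivial frame. Since the root then refutes \<open>\<box>A\<close>, soundness also makes
  \<open>\<box>\<close>-elimination admissible in the bullet logic.

  The worlds of the countermodel are the strictly increasing chains of finite maximal
  consistent sets, ordered by proper extension, with the empty chain as root. At a
  non-terminal chain \<open>\<blacksquare>\<close> agrees with \<open>\<box>\<close>. At a terminal chain the relation for
  \<open>B\<close> points to proper extensions of its immediate predecessor chain \<open>p\<close> that decide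
  \<open>B\<close> in the way prescribed by \<open>\<blacksquare>B\<close>. Such extensions exist by the axioms
  \<open>\<diamond>\<blacksquare>B \<longrightarrow> \<diamond>B\<close> and \<open>\<box>B \<longrightarrow> \<box>\<blacksquare>B\<close> if \<open>p\<close> is non-empty, and by the two rules
  of the bullet logic if \<open>p\<close> is empty.
\<close>

section \<open>Derivability\<close>

lemma derivable_taut:
  assumes "tautology A"
  shows "derivable rules A"
  using assms by (intro derivable.Axiom GR_axiom.Taut)

lemma derivable_taut1:
  assumes "derivable rules A" and "tautology (Imp A B)"
  shows "derivable rules B"
  using derivable.MP[OF derivable_taut[OF assms(2)] assms(1)] .

lemma derivable_taut2:
  assumes "derivable rules A" and "derivable rules B"
    and "tautology (Imp A (Imp B C))"
  shows "derivable rules C"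
  using derivable.MP[OF derivable.MP[OF derivable_taut[OF assms(3)] assms(1)] assms(2)] .

lemma derivable_taut3:
  assumes "derivable rules A" and "derivable rules B" and "derivable rules C"
    and "tautology (Imp A (Imp B (Imp C D)))"
  shows "derivable rules D"
  using derivable.MP[OF derivable.MP[OF derivable.MP[OF derivable_taut[OF assms(4)] assms(1)]
      assms(2)] assms(3)] .

lemma derivable_Box_mono:
  assumes "derivable rules (Imp A B)"
  shows "derivable rules (Imp (Box A) (Box B))"
  using derivable.MP[OF derivable.Axiom[OF GR_axiom.K] derivable.Box_Nec[OF assms]] .

lemma derivable_Box_conj:
  "derivable rules (Imp (Box A) (Imp (Box B) (Box (Neg (Or (Neg A) (Neg B))))))"
proof -
  have "derivable rules (Imp (Box A) (Box (Imp B (Neg (Or (Neg A) (Neg B))))))"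
    by (intro derivable_Box_mono derivable_taut) (auto simp: tautology_def)
  then show ?thesis
    by (rule derivable_taut2[OF _ derivable.Axiom[OF GR_axiom.K[of B "Neg (Or (Neg A) (Neg B))"]]])
      (auto simp: tautology_def)
qed

text \<open>Unlike in pure provability logic, Loeb's axiom is not involved: \<open>\<box>A\<close> yields \<open>\<box>\<blacksquare>A\<close>, hence \<open>\<box>\<box>A\<close>.\<close>

lemma derivable_Box_Box: "derivable rules (Imp (Box A) (Box (Box A)))"
  by (rule derivable_taut2[OF derivable.Axiom[OF GR_axiom.Box_Box_BBox[of A]]
        derivable_Box_mono[OF derivable.Axiom[OF GR_axiom.BBox_Box[of A]]]])
    (auto simp: tautology_def)

text \<open>Boxing the premise turns \<open>Box G\<close> into \<open>Box (Imp (Box A) A)\<close>,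
  and Loeb's axiom finishes. This is what makes successors consistent in
  \<open>rel_exists\<close>.\<close>

lemma derivable_Loeb_rule:
  assumes "derivable rules (Imp G (Imp (Box A) A))"
  shows "derivable rules (Imp (Box G) (Box A))"
  by (rule derivable_taut2[OF derivable_Box_mono[OF assms] derivable.Axiom[OF GR_axiom.Loeb[of A]]])
    (auto simp: tautology_def)

section \<open>The extra rules and their derivability in \<open>GR\<close>\<close>

lemma GR_bullet_BBox:
  assumes "GR_bullet A"
  shows "GR_bullet (BBox A)"
  using assms unfolding GR_bullet_def
  by (rule derivable.Extra[rotated]) (simp add: BBox_nec_rule_def)

lemma GR_bullet_Neg_BBox:
  assumes "GR_bullet (Neg A)"
  shows "GR_bullet (Neg (BBox A))"
  using assms unfolding GR_bullet_def
  by (rule derivable.Extra[rotated]) (simp add: Neg_BBox_rule_def)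

lemma GR_if_Box:
  assumes "GR (Box A)"
  shows "GR A"
  using assms unfolding GR_def
  by (rule derivable.Extra[rotated]) (simp add: Box_elim_rule_def)

text \<open>Necessitation and the axiom \<open>Imp (Box A) (Box (BBox A))\<close> yield the goal
  under a \<open>Box\<close>, which the rule of \<open>GR\<close> removes.\<close>

lemma GR_BBox:
  assumes "GR A"
  shows "GR (BBox A)"
proof (rule GR_if_Box)
  show "GR (Box (BBox A))"
    using assms unfolding GR_def
    by (intro derivable.MP[OF derivable.Axiom[OF GR_axiom.Box_Box_BBox]] derivable.Box_Nec)
qed

text \<open>The contrapositive of \<open>Imp (Dia (BBox A)) (Dia A)\<close> leads from
  \<open>Box (Neg A)\<close> to \<open>Box (Neg (BBox A))\<close>.\<close>

lemma GR_Neg_BBox: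
  assumes "GR (Neg A)"
  shows "GR (Neg (BBox A))"
proof (rule GR_if_Box)
  have "GR (Box (Neg A))"
    using assms unfolding GR_def by (rule derivable.Box_Nec)
  then show "GR (Box (Neg (BBox A)))"
    unfolding GR_def
    by (rule derivable_taut2[OF _ derivable.Axiom[OF GR_axiom.Dia_BBox_Dia[of A]]])
      (auto simp: tautology_def)
qed

lemma GR_bullet_imp_GR:
  assumes "GR_bullet A"
  shows "GR A"
  using assms unfolding GR_bullet_def
proof (induction rule: derivable.induct)
  case (Extra A B)
  then show ?case
    by (auto simp: BBox_nec_rule_def Neg_BBox_rule_def intro: GR_BBox GR_Neg_BBox)
qed (auto simp: GR_def intro: derivable.intros)

section \<open>Soundness\<close>

text \<open>Truth at a fixed world is itself a propositional valuation with modal formulas as atoms,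
  so tautologies are true there.\<close>

lemma prop_eval_forces: "prop_eval (forces R S V w) A = forces R S V w A"
  by (induction A) auto

lemma GRo_frameD:
  assumes "GRo_frame W R S"
  shows "W \<noteq> {}" and "R \<subseteq> W \<times> W" and "trans R" and "wf (R\<inverse>)" and "S B \<subseteq> W \<times> W"
  using assms by (simp_all add: GRo_frame_def)

text \<open>Both relations lie inside \<open>W\<close>, so the four conditions can be used without
  membership guards.\<close>

lemma GRo_frame_conditions:
  assumes F: "GRo_frame W R S"
  shows "(x, y) \<in> R \<Longrightarrow> (x, y) \<in> S B"
    and "(x, y) \<in> R \<Longrightarrow> (y, z) \<in> S B \<Longrightarrow> (x, z) \<in> R"
    and "(x, y) \<in> S B \<Longrightarrow> (x, z) \<in> R \<Longrightarrow> (x, y) \<in> R"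
    and "(x, y) \<in> R \<Longrightarrow> \<exists>z. (y, z) \<in> S B \<and> (x, z) \<in> R"
proof -
  have RW: "x \<in> W" "y \<in> W" if "(x, y) \<in> R" for x y
    using that GRo_frameD(2)[OF F] by blast+
  have SW: "x \<in> W" "y \<in> W" if "(x, y) \<in> S B" for x y
    using that GRo_frameD(5)[OF F] by blast+
  show "(x, y) \<in> S B" if "(x, y) \<in> R"
    using F RW[OF that] that unfolding GRo_frame_def by meson
  show "(x, z) \<in> R" if "(x, y) \<in> R" "(y, z) \<in> S B"
    using F RW[OF that(1)] SW[OF that(2)] that unfolding GRo_frame_def by meson
  show "(x, y) \<in> R" if "(x, y) \<in> S B" "(x, z) \<in> R"
    using F SW[OF that(1)] RW[OF that(2)] that unfolding GRo_frame_def by meson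
  show "\<exists>z. (y, z) \<in> S B \<and> (x, z) \<in> R" if "(x, y) \<in> R"
    using F RW[OF that] that unfolding GRo_frame_def by meson
qed

text \<open>Each of the four axioms with \<open>BBox\<close> matches one of the four frame
  conditions, in the same order; Loeb's axiom comes from transitivity and converse
  well-foundedness.\<close>

lemma GR_axiom_sound:
  assumes "GR_axiom A" and F: "GRo_frame W R S"
  shows "forces R S V w A"
  using assms(1)
proof cases
  case Taut
  then show ?thesis
    using prop_eval_forces[of R S V w A] by (auto simp: tautology_def)
next
  case (K A B)
  then show ?thesis by auto
next
  case (Loeb B)
  note wf = GRo_frameD(4)[OF F] and tr = GRo_frameD(3)[OF F]
  have "forces R S V w (Box B)" if h: "forces R S V w (Box (Imp (Box B) B))"
  proof -
    \<comment> \<open>The induction hypothesis covers the successors of \<open>v\<close>, which by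
      transitivity are successors of \<open>w\<close>. So \<open>Box B\<close> holds at
      \<open>v\<close>, and \<open>h\<close> gives \<open>B\<close> there.\<close>
    have "(w, v) \<in> R \<longrightarrow> forces R S V v B" for v
      using wf
    proof (induction v rule: wf_induct_rule)
      case (less v)
      show ?case
      proof
        assume wv: "(w, v) \<in> R"
        have "forces R S V u B" if vu: "(v, u) \<in> R" for u
          using less[of u] vu transD[OF tr wv vu] by simp
        then show "forces R S V v B"
          using h wv by simp blast
      qed
    qed
    then show ?thesis by simp
  qed
  then show ?thesis
    unfolding Loeb forces.simps(3,4) by blast
next
  case (BBox_Box B)
  then show ?thesis
    using GRo_frame_conditions(1)[OF F] by auto
next
  case (Box_Box_BBox B)
  then show ?thesis
    using GRo_frame_conditions(2)[OF F, of w _ _ B] by auto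
next
  case (Box_Bot_BBox B)
  then show ?thesis
    using GRo_frame_conditions(3)[OF F, of w _ B] by auto
next
  case (Dia_BBox_Dia B)
  then show ?thesis
    using GRo_frame_conditions(4)[OF F, of w _ B] by fastforce
qed

text \<open>Seriality enters for the rule leading to \<open>Neg (BBox C)\<close>: some successor
  must exist at which \<open>C\<close> fails.\<close>

lemma GR_bullet_sound:
  assumes "GR_bullet A" and F: "GRo_frame W R S" and ser: "BBox_serial W S"
  shows "valid_on W R S A"
  using assms(1) unfolding GR_bullet_def
proof (induction rule: derivable.induct)
  case (Axiom A)
  then show ?case
    using GR_axiom_sound[OF _ F] by (simp add: valid_on_def)
next
  case (MP A B)
  then show ?case
    by (auto simp: valid_on_def)
next
  case (Box_Nec A)
  then show ?case
    using GRo_frameD(2)[OF F] by (auto simp: valid_on_def)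
next
  case (Extra A B)
  have *: "v \<in> W" if "(w, v) \<in> S C" for w v C
    using that GRo_frameD(5)[OF F] by blast
  from Extra(1) consider "B = BBox A" | C where "A = Neg C" "B = Neg (BBox C)"
    by (auto simp: BBox_nec_rule_def Neg_BBox_rule_def)
  then show ?case
  proof cases
    case 1
    then show ?thesis
      using Extra.IH * by (auto simp: valid_on_def)
  next
    case (2 C)
    show ?thesis
      unfolding valid_on_def
    proof (intro allI impI ballI)
      fix V :: "nat \<Rightarrow> _" and w
      assume V: "\<forall>p. V p \<subseteq> W" and "w \<in> W"
      then obtain y where y: "y \<in> W" "(w, y) \<in> S C"
        using ser unfolding BBox_serial_def by blast
      then have "\<not> forces R S V y C"
        using Extra.IH V 2 by (auto simp: valid_on_def)
      then show "forces R S V w B"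
        using 2 y by auto
    qed
  qed
qed

text \<open>The root sees the second world by condition (i). Any other world lies above the root,
  and condition (iv) gives it a successor.\<close>

lemma nontrivial_imp_BBox_serial:
  assumes F: "GRo_frame W R S" and "nontrivial W R"
  shows "BBox_serial W S"
  unfolding BBox_serial_def
proof (intro allI ballI)
  fix B x
  assume x: "x \<in> W"
  obtain r w where r: "r \<in> W" "w \<in> W" "r \<noteq> w" "\<And>y. y \<in> W \<Longrightarrow> y \<noteq> r \<Longrightarrow> (r, y) \<in> R"
    using assms(2) by (auto simp: nontrivial_def)
  show "\<exists>y\<in>W. (x, y) \<in> S B"
  proof (cases "x = r")
    case True
    then have "(x, w) \<in> S B"
      using r GRo_frame_conditions(1)[OF F] by auto
    then show ?thesis using r by blast
  next
    case False
    then have "(r, x) \<in> R" using r x by blast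
    then show ?thesis
      using GRo_frame_conditions(4)[OF F] GRo_frameD(5)[OF F] by blast
  qed
qed

section \<open>Isomorphic copies of frames\<close>

text \<open>Countermodels are built on lists of formula sets; this transports them to an arbitrary
  infinite type.\<close>

definition pull_rel :: "'b set \<Rightarrow> ('b \<Rightarrow> 'a) \<Rightarrow> 'a rel \<Rightarrow> 'b rel" where
  "pull_rel W g R = {(a, b). a \<in> W \<and> b \<in> W \<and> (g a, g b) \<in> R}"

text \<open>The universal conditions transfer directly; the witness of condition (iv) is pulled back
  by surjectivity of \<open>g\<close>.\<close>

lemma GRo_frame_pull:
  assumes F: "GRo_frame W R S" and g: "bij_betw g W' W"
  shows "GRo_frame W' (pull_rel W' g R) (\<lambda>B. pull_rel W' g (S B))"
proof -
  have ex: "\<exists>a\<in>W'. g a = z" if "z \<in> W" for z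
    using g that by (auto simp: bij_betw_def)
  note sub = GRo_frameD(2,5)[OF F] and con = GRo_frame_conditions[OF F]
  have pull_iff: "(a, b) \<in> pull_rel W' g Q \<longleftrightarrow> a \<in> W' \<and> b \<in> W' \<and> (g a, g b) \<in> Q" for a b Q
    by (simp add: pull_rel_def)
  have "wf (inv_image (R\<inverse>) g)"
    using GRo_frameD(4)[OF F] by simp
  then have wf: "wf ((pull_rel W' g R)\<inverse>)"
    by (rule wf_subset) (auto simp: pull_rel_def)
  have tr: "trans (pull_rel W' g R)"
    using GRo_frameD(3)[OF F] unfolding trans_def pull_iff by blast
  have ne: "W' \<noteq> {}"
    using GRo_frameD(1)[OF F] g by (auto simp: bij_betw_def)
  have pull_sub: "pull_rel W' g Q \<subseteq> W' \<times> W'" for Q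
    by (auto simp: pull_rel_def)
  have ex': "\<exists>z\<in>W'. (y, z) \<in> pull_rel W' g (S B) \<and> (x, z) \<in> pull_rel W' g R"
    if xy: "(x, y) \<in> pull_rel W' g R" for B x y
  proof -
    have m: "x \<in> W'" "y \<in> W'" "(g x, g y) \<in> R"
      using xy by (auto simp: pull_rel_def)
    obtain z where z: "(g y, z) \<in> S B" "(g x, z) \<in> R"
      using con(4)[OF m(3)] by blast
    then obtain c where "c \<in> W'" "g c = z"
      using sub(1) ex by blast
    then show ?thesis
      using m z by (auto simp: pull_rel_def)
  qed
  show ?thesis
    unfolding GRo_frame_def
    by (intro conjI allI ballI impI ne pull_sub tr wf ex'; (elim conjE)?; unfold pull_iff; elim conjE)
      (use con in \<open>(assumption | blast)+\<close>)
qed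

lemma nontrivial_pull:
  assumes "nontrivial W R" and g: "bij_betw g W' W"
  shows "nontrivial W' (pull_rel W' g R)"
proof -
  obtain r w where r: "r \<in> W" "w \<in> W" "r \<noteq> w" "\<And>y. y \<in> W \<Longrightarrow> y \<noteq> r \<Longrightarrow> (r, y) \<in> R"
    using assms(1) by (auto simp: nontrivial_def)
  obtain a b where ab: "a \<in> W'" "g a = r" "b \<in> W'" "g b = w"
    using g r by (auto simp: bij_betw_def)
  have "(a, x) \<in> pull_rel W' g R" if "x \<in> W'" "x \<noteq> a" for x
  proof -
    have "g x \<in> W" "g x \<noteq> r"
      using g that ab by (auto simp: bij_betw_def inj_on_def)
    then show ?thesis
      using r ab that by (auto simp: pull_rel_def)
  qed
  moreover have "a \<noteq> b" using ab r by auto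
  ultimately show ?thesis
    using ab by (auto simp: nontrivial_def)
qed

lemma forces_pull:
  assumes F: "GRo_frame W R S" and g: "bij_betw g W' W" and "a \<in> W'"
  shows "forces (pull_rel W' g R) (\<lambda>B. pull_rel W' g (S B)) (\<lambda>p. {a \<in> W'. g a \<in> V p}) a A
    \<longleftrightarrow> forces R S V (g a) A"
  using assms(3)
proof (induction A arbitrary: a)
  case (Box A)
  note sub = GRo_frameD(2)[OF F]
  have gs: "g ` W' = W"
    using g by (auto simp: bij_betw_def)
  have "(\<forall>b. (a, b) \<in> pull_rel W' g R \<longrightarrow> forces R S V (g b) A) \<longleftrightarrow>
      (\<forall>v. (g a, v) \<in> R \<longrightarrow> forces R S V v A)"
    using sub gs Box.prems unfolding pull_rel_def by blast
  moreover have "b \<in> W'" if "(a, b) \<in> pull_rel W' g R" for b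
    using that by (auto simp: pull_rel_def)
  ultimately show ?case
    using Box.IH by auto
next
  case (BBox A)
  note sub = GRo_frameD(5)[OF F, of A]
  have gs: "g ` W' = W"
    using g by (auto simp: bij_betw_def)
  have "(\<forall>b. (a, b) \<in> pull_rel W' g (S A) \<longrightarrow> forces R S V (g b) A) \<longleftrightarrow>
      (\<forall>v. (g a, v) \<in> S A \<longrightarrow> forces R S V v A)"
    using sub gs BBox.prems unfolding pull_rel_def by blast
  moreover have "b \<in> W'" if "(a, b) \<in> pull_rel W' g (S A)" for b
    using that by (auto simp: pull_rel_def)
  ultimately show ?case
    using BBox.IH by auto
qed auto

text \<open>A valuation on \<open>W\<close> is pulled back along \<open>g\<close>, so a refutation
  on the original frame becomes one on the copy.\<close>

lemma valid_on_pull: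
  assumes F: "GRo_frame W R S" and g: "bij_betw g W' W"
    and val: "valid_on W' (pull_rel W' g R) (\<lambda>B. pull_rel W' g (S B)) A"
  shows "valid_on W R S A"
  unfolding valid_on_def
proof (intro allI impI ballI)
  fix V :: "nat \<Rightarrow> _" and w
  assume "w \<in> W"
  then obtain a where a: "a \<in> W'" "g a = w"
    using g by (auto simp: bij_betw_def)
  have "forces (pull_rel W' g R) (\<lambda>B. pull_rel W' g (S B)) (\<lambda>p. {a \<in> W'. g a \<in> V p}) a A"
    using val a by (auto simp: valid_on_def)
  then show "forces R S V w A"
    using forces_pull[OF F g a(1), of V A] a(2) by simp
qed

section \<open>Finite maximal consistent sets\<close>

text \<open>A maximal consistent subset \<open>x\<close> of \<Phi>, with consistency witnessed by
  one formula \<open>F\<close> in place of the conjunction of all members and negated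
  non-members.\<close>

definition decides :: "fm set \<Rightarrow> fm \<Rightarrow> fm set \<Rightarrow> bool" where
  "decides \<Phi> F x \<longleftrightarrow> \<not> GR_bullet (Neg F) \<and> x \<subseteq> \<Phi> \<and>
     (\<forall>B\<in>x. GR_bullet (Imp F B)) \<and> (\<forall>B\<in>\<Phi> - x. GR_bullet (Imp F (Neg B)))"

text \<open>Lindenbaum's lemma for a finite set: the formulas are decided one at a time, and
  conjoining either \<open>B\<close> or its negation keeps the current formula consistent.\<close>

lemma decides_exists:
  assumes "finite \<Phi>" and "\<not> GR_bullet (Neg F)"
  shows "\<exists>G x. GR_bullet (Imp G F) \<and> decides \<Phi> G x"
  using assms(1)
proof (induction rule: finite_induct)
  case empty
  have "GR_bullet (Imp F F)"
    unfolding GR_bullet_def by (rule derivable_taut) (auto simp: tautology_def)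
  then show ?case
    using assms(2) by (auto simp: decides_def)
next
  case (insert B \<Phi>)
  then obtain G x where G: "GR_bullet (Imp G F)" "decides \<Phi> G x"
    by blast
  \<comment> \<open>These are the conjunctions of \<open>G\<close> with \<open>B\<close> and of
    \<open>G\<close> with \<open>Neg B\<close>.\<close>
  let ?P = "Neg (Or (Neg G) (Neg B))" and ?N = "Neg (Or (Neg G) B)"
  have P: "GR_bullet (Imp ?P C)" and N: "GR_bullet (Imp ?N C)" if "GR_bullet (Imp G C)" for C
    using that unfolding GR_bullet_def
    by (rule derivable_taut1, auto simp: tautology_def)+
  have "\<not> GR_bullet (Neg ?P) \<or> \<not> GR_bullet (Neg ?N)"
  proof (rule ccontr)
    assume "\<not> ?thesis"
    then have "GR_bullet (Neg ?P)" "GR_bullet (Neg ?N)" by auto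
    then have "GR_bullet (Neg G)"
      unfolding GR_bullet_def by (rule derivable_taut2) (auto simp: tautology_def)
    then show False using G(2) by (simp add: decides_def)
  qed
  then show ?case
  proof
    assume "\<not> GR_bullet (Neg ?P)"
    moreover have "GR_bullet (Imp ?P B)"
      unfolding GR_bullet_def by (rule derivable_taut) (auto simp: tautology_def)
    ultimately have "decides (insert B \<Phi>) ?P (insert B x)"
      using G(2) P by (auto simp: decides_def)
    then show ?thesis using P[OF G(1)] by blast
  next
    assume "\<not> GR_bullet (Neg ?N)"
    moreover have "GR_bullet (Imp ?N (Neg B))"
      unfolding GR_bullet_def by (rule derivable_taut) (auto simp: tautology_def)
    ultimately have "decides (insert B \<Phi>) ?N x"
      using G(2) N by (auto simp: decides_def)
    then show ?thesis using N[OF G(1)] by blast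
  qed
qed

lemma decides_mem_iff:
  assumes "decides \<Phi> F x" and "C \<in> \<Phi>"
  shows "C \<in> x \<longleftrightarrow> GR_bullet (Imp F C)"
proof
  assume FC: "GR_bullet (Imp F C)"
  show "C \<in> x"
  proof (rule ccontr)
    assume "C \<notin> x"
    then have "GR_bullet (Imp F (Neg C))"
      using assms by (simp add: decides_def)
    with FC have "GR_bullet (Neg F)"
      unfolding GR_bullet_def by (rule derivable_taut2) (auto simp: tautology_def)
    then show False using assms by (simp add: decides_def)
  qed
qed (use assms in \<open>simp add: decides_def\<close>)

lemma decides_notin_iff:
  assumes "decides \<Phi> F x" and "C \<in> \<Phi>"
  shows "C \<notin> x \<longleftrightarrow> GR_bullet (Imp F (Neg C))"
proof
  assume FC: "GR_bullet (Imp F (Neg C))"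
  show "C \<notin> x"
  proof
    assume "C \<in> x"
    then have "GR_bullet (Imp F C)"
      using assms by (simp add: decides_def)
    then have "GR_bullet (Neg F)"
      using FC unfolding GR_bullet_def by (rule derivable_taut2) (auto simp: tautology_def)
    then show False using assms by (simp add: decides_def)
  qed
qed (use assms in \<open>simp add: decides_def\<close>)

text \<open>\<open>G\<close> is the conjunction of \<open>X\<close>, built by induction;
  \<open>Box\<close> commutes with conjunction.\<close>

lemma Box_interpolant:
  assumes "finite X" and "\<And>B. B \<in> X \<Longrightarrow> GR_bullet (Imp F (Box B))"
  shows "\<exists>G. GR_bullet (Imp F (Box G)) \<and> (\<forall>B\<in>X. GR_bullet (Imp G B))"
  using assms
proof (induction rule: finite_induct)
  case empty
  \<comment> \<open>\<open>Neg Bot\<close> serves as the empty conjunction.\<close>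
  have "derivable rules (Box (Neg Bot))" for rules
    by (intro derivable.Box_Nec derivable_taut) (auto simp: tautology_def)
  then have "GR_bullet (Imp F (Box (Neg Bot)))"
    unfolding GR_bullet_def by (rule derivable_taut1) (auto simp: tautology_def)
  then show ?case by blast
next
  case (insert B X)
  then obtain G where G: "GR_bullet (Imp F (Box G))" "\<forall>C\<in>X. GR_bullet (Imp G C)"
    by blast
  let ?G = "Neg (Or (Neg G) (Neg B))"
  have "GR_bullet (Imp F (Box B))" using insert.prems by blast
  with G(1) have "GR_bullet (Imp F (Box ?G))"
    unfolding GR_bullet_def
    by (rule derivable_taut3[OF _ _ derivable_Box_conj[of _ G B]]) (auto simp: tautology_def)
  moreover have "GR_bullet (Imp ?G C)" if "GR_bullet (Imp G C)" for C
    using that unfolding GR_bullet_def by (rule derivable_taut1) (auto simp: tautology_def)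
  moreover have "GR_bullet (Imp ?G B)"
    unfolding GR_bullet_def by (rule derivable_taut) (auto simp: tautology_def)
  ultimately show ?case using G(2) by blast
qed

section \<open>The chain model\<close>

text \<open>\<open>\<Gamma>\<close> will be the subformulas of an unprovable formula together with
  \<open>Bot\<close>. Having \<open>Bot\<close> there lets worlds decide
  \<open>Box Bot\<close>.\<close>

locale chain_model =
  fixes \<Gamma> :: "fm set"
  assumes fin: "finite \<Gamma>"
    and Bot_mem: "Bot \<in> \<Gamma>"
    and Neg_mem: "Neg B \<in> \<Gamma> \<Longrightarrow> B \<in> \<Gamma>"
    and Or_mem: "Or B C \<in> \<Gamma> \<Longrightarrow> B \<in> \<Gamma> \<and> C \<in> \<Gamma>"
    and Box_mem: "Box B \<in> \<Gamma> \<Longrightarrow> B \<in> \<Gamma>"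
    and BBox_mem: "BBox B \<in> \<Gamma> \<Longrightarrow> B \<in> \<Gamma>"
    and consistent: "\<not> GR_bullet Bot"
begin

section \<open>Worlds and their accessibility relation\<close>

text \<open>For \<open>BBox B\<close> in \<open>\<Gamma>\<close>, worlds must also decide the boxes
  of \<open>B\<close>, \<open>BBox B\<close> and their negations, since the axioms linking the two
  modalities relate these.\<close>

definition \<Phi> :: "fm set" where
  "\<Phi> = \<Gamma> \<union> Neg ` \<Gamma> \<union> Box ` (\<Gamma> \<union> Neg ` \<Gamma>)"

lemma finite_\<Phi>: "finite \<Phi>"
  using fin by (simp add: \<Phi>_def)

lemma Box_\<Phi>D: "Box B \<in> \<Phi> \<Longrightarrow> B \<in> \<Phi>"
  using Box_mem by (auto simp: \<Phi>_def)

definition worlds :: "fm set set" where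
  "worlds = {x. \<exists>F. decides \<Phi> F x}"

lemma finite_worlds: "finite worlds"
proof (rule finite_subset)
  show "worlds \<subseteq> Pow \<Phi>" by (auto simp: worlds_def decides_def)
qed (simp add: finite_\<Phi>)

lemma Neg_world:
  assumes "x \<in> worlds" and "B \<in> \<Phi>" and "Neg B \<in> \<Phi>"
  shows "Neg B \<in> x \<longleftrightarrow> B \<notin> x"
  using assms decides_mem_iff decides_notin_iff unfolding worlds_def by blast

lemma Bot_world:
  assumes "x \<in> worlds"
  shows "Bot \<notin> x"
proof -
  obtain F where F: "decides \<Phi> F x" using assms by (auto simp: worlds_def)
  have "GR_bullet (Imp F (Neg Bot))"
    unfolding GR_bullet_def by (rule derivable_taut) (auto simp: tautology_def)
  then show ?thesis
    using decides_notin_iff[OF F, of Bot] Bot_mem by (simp add: \<Phi>_def)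
qed

lemma Or_world:
  assumes x: "x \<in> worlds" and m: "B \<in> \<Phi>" "C \<in> \<Phi>" "Or B C \<in> \<Phi>"
  shows "Or B C \<in> x \<longleftrightarrow> B \<in> x \<or> C \<in> x"
proof -
  obtain F where F: "decides \<Phi> F x" using x by (auto simp: worlds_def)
  note i = decides_mem_iff[OF F] decides_notin_iff[OF F]
  have "Or B C \<in> x" if "B \<in> x"
  proof -
    have "GR_bullet (Imp F B)" using that i m by blast
    then have "GR_bullet (Imp F (Or B C))"
      unfolding GR_bullet_def by (rule derivable_taut1) (auto simp: tautology_def)
    then show ?thesis using i m by blast
  qed
  moreover have "Or B C \<in> x" if "C \<in> x"
  proof -
    have "GR_bullet (Imp F C)" using that i m by blast
    then have "GR_bullet (Imp F (Or B C))"
      unfolding GR_bullet_def by (rule derivable_taut1) (auto simp: tautology_def)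
    then show ?thesis using i m by blast
  qed
  moreover have "Or B C \<notin> x" if "B \<notin> x" "C \<notin> x"
  proof -
    have "GR_bullet (Imp F (Neg B))" "GR_bullet (Imp F (Neg C))" using that i m by blast+
    then have "GR_bullet (Imp F (Neg (Or B C)))"
      unfolding GR_bullet_def by (rule derivable_taut2) (auto simp: tautology_def)
    then show ?thesis using i m by blast
  qed
  ultimately show ?thesis by blast
qed

text \<open>The usual relation of finite canonical models of provability logic: persistence of boxes
  gives transitivity, the new box gives irreflexivity.\<close>

definition rel :: "fm set \<Rightarrow> fm set \<Rightarrow> bool" where
  "rel x y \<longleftrightarrow> (\<forall>C. Box C \<in> x \<longrightarrow> C \<in> y \<and> Box C \<in> y) \<and> (\<exists>C. Box C \<in> y \<and> Box C \<notin> x)"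

lemma rel_trans: "rel x y \<Longrightarrow> rel y z \<Longrightarrow> rel x z"
  unfolding rel_def by blast

text \<open>The world \<open>y\<close> contains all that \<open>x\<close> demands, together with
  \<open>Box C\<close> and without \<open>C\<close>; Loeb's axiom makes this consistent.
  \<open>Box C\<close> is the new box that \<open>rel\<close> asks for.\<close>

lemma rel_exists:
  assumes F: "decides \<Phi> F x" and C: "Box C \<in> \<Phi>" "\<not> GR_bullet (Imp F (Box C))"
  shows "\<exists>y\<in>worlds. rel x y \<and> C \<notin> y"
proof -
  have C\<Phi>: "C \<in> \<Phi>" using C Box_\<Phi>D by blast
  have Cx: "Box C \<notin> x" using decides_mem_iff[OF F] C by blast
  \<comment> \<open>The second part makes boxes persist; its members can be boxed by
    \<open>derivable_Box_Box\<close>.\<close>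
  define X where "X = {B. Box B \<in> x} \<union> {B \<in> x. \<exists>D. B = Box D}"
  have x\<Phi>: "x \<subseteq> \<Phi>" using F by (simp add: decides_def)
  have "X \<subseteq> \<Phi>"
    using x\<Phi> Box_\<Phi>D by (auto simp: X_def)
  then have "finite X" using finite_\<Phi> finite_subset by blast
  moreover have "GR_bullet (Imp F (Box B))" if BX: "B \<in> X" for B
  proof (cases "Box B \<in> x")
    case True
    then show ?thesis using F by (simp add: decides_def)
  next
    case False
    then obtain D where D: "B = Box D" "Box D \<in> x" using BX by (auto simp: X_def)
    then have "GR_bullet (Imp F (Box D))" using F by (simp add: decides_def)
    then show ?thesis
      unfolding D GR_bullet_def
      by (rule derivable_taut2[OF _ derivable_Box_Box[of _ D]]) (auto simp: tautology_def)
  qed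
  ultimately obtain G where G: "GR_bullet (Imp F (Box G))" "\<forall>B\<in>X. GR_bullet (Imp G B)"
    using Box_interpolant by blast
  \<comment> \<open>The conjunction of \<open>G\<close>, \<open>Box C\<close> and
    \<open>Neg C\<close>.\<close>
  let ?H = "Neg (Or (Neg G) (Or (Neg (Box C)) C))"
  have "\<not> GR_bullet (Neg ?H)"
  proof
    assume "GR_bullet (Neg ?H)"
    then have "GR_bullet (Imp G (Imp (Box C) C))"
      unfolding GR_bullet_def by (rule derivable_taut1) (auto simp: tautology_def)
    then have "GR_bullet (Imp (Box G) (Box C))"
      unfolding GR_bullet_def by (rule derivable_Loeb_rule)
    with G(1) have "GR_bullet (Imp F (Box C))"
      unfolding GR_bullet_def by (rule derivable_taut2) (auto simp: tautology_def)
    then show False using C by blast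
  qed
  then obtain K y where K: "GR_bullet (Imp K ?H)" "decides \<Phi> K y"
    using decides_exists finite_\<Phi> by blast
  note i = decides_mem_iff[OF K(2)] decides_notin_iff[OF K(2)]
  have "B \<in> y" if "B \<in> X" for B
  proof -
    have "GR_bullet (Imp G B)" using that G by blast
    with K(1) have "GR_bullet (Imp K B)"
      unfolding GR_bullet_def by (rule derivable_taut2) (auto simp: tautology_def)
    then show ?thesis using i that \<open>X \<subseteq> \<Phi>\<close> by blast
  qed
  then have "\<forall>B. Box B \<in> x \<longrightarrow> B \<in> y \<and> Box B \<in> y"
    by (auto simp: X_def)
  moreover have "GR_bullet (Imp K (Box C))" "GR_bullet (Imp K (Neg C))"
    using K(1) unfolding GR_bullet_def by (rule derivable_taut1, auto simp: tautology_def)+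
  then have "Box C \<in> y" "C \<notin> y"
    using i C(1) C\<Phi> by blast+
  ultimately show ?thesis
    using K(2) Cx by (auto simp: rel_def worlds_def)
qed

lemma Box_world:
  assumes x: "x \<in> worlds" and C: "Box C \<in> \<Phi>"
  shows "Box C \<in> x \<longleftrightarrow> (\<forall>y\<in>worlds. rel x y \<longrightarrow> C \<in> y)"
proof -
  obtain F where F: "decides \<Phi> F x" using x by (auto simp: worlds_def)
  show ?thesis
    using rel_exists[OF F C] decides_mem_iff[OF F C] unfolding rel_def by blast
qed

text \<open>The two rules of the bullet logic handle the worlds without a predecessor.\<close>

lemma BBox_world_initial:
  assumes x: "x \<in> worlds" and B: "BBox B \<in> \<Gamma>"
  shows "\<exists>z\<in>worlds. B \<in> z \<longleftrightarrow> BBox B \<in> x"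
proof -
  obtain F where F: "decides \<Phi> F x" using x by (auto simp: worlds_def)
  have F_con: "\<not> GR_bullet (Neg F)" using F by (simp add: decides_def)
  have m: "B \<in> \<Phi>" "BBox B \<in> \<Phi>" using B BBox_mem by (auto simp: \<Phi>_def)
  show ?thesis
  proof (cases "BBox B \<in> x")
    case True
    have "\<not> GR_bullet (Neg B)"
    proof
      assume "GR_bullet (Neg B)"
      then have "GR_bullet (Neg (BBox B))" by (rule GR_bullet_Neg_BBox)
      moreover have "GR_bullet (Imp F (BBox B))" using True F by (simp add: decides_def)
      ultimately have "GR_bullet (Neg F)"
        unfolding GR_bullet_def by (rule derivable_taut2) (auto simp: tautology_def)
      then show False using F_con by blast
    qed
    then obtain G z where G: "GR_bullet (Imp G B)" "decides \<Phi> G z"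
      using decides_exists finite_\<Phi> by blast
    then show ?thesis
      using True decides_mem_iff[OF G(2) m(1)] by (auto simp: worlds_def)
  next
    case False
    have "\<not> GR_bullet (Neg (Neg B))"
    proof
      assume "GR_bullet (Neg (Neg B))"
      then have "GR_bullet B"
        unfolding GR_bullet_def by (rule derivable_taut1) (auto simp: tautology_def)
      then have "GR_bullet (BBox B)" by (rule GR_bullet_BBox)
      moreover have "GR_bullet (Imp F (Neg (BBox B)))"
        using False F m by (simp add: decides_def)
      ultimately have "GR_bullet (Neg F)"
        unfolding GR_bullet_def by (rule derivable_taut2) (auto simp: tautology_def)
      then show False using F_con by blast
    qed
    then obtain G z where G: "GR_bullet (Imp G (Neg B))" "decides \<Phi> G z"
      using decides_exists finite_\<Phi> by blast
    then show ?thesis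
      using False decides_notin_iff[OF G(2) m(1)] by (auto simp: worlds_def)
  qed
qed

text \<open>If no successor of \<open>u\<close> had \<open>B\<close>, then \<open>u\<close> would
  contain \<open>Box (Neg B)\<close>, hence imply \<open>Box (Neg (BBox B))\<close>, against
  \<open>BBox B\<close> in \<open>x\<close>. Dually, \<open>Box B\<close> would imply
  \<open>Box (BBox B)\<close>.\<close>

lemma BBox_world_successor:
  assumes u: "u \<in> worlds" and x: "x \<in> worlds" and ux: "rel u x" and B: "BBox B \<in> \<Gamma>"
  shows "\<exists>z\<in>worlds. rel u z \<and> (B \<in> z \<longleftrightarrow> BBox B \<in> x)"
proof -
  obtain F where F: "decides \<Phi> F u" using u by (auto simp: worlds_def)
  have m: "B \<in> \<Phi>" "BBox B \<in> \<Phi>" "Box B \<in> \<Phi>" "Neg B \<in> \<Phi>" "Neg (BBox B) \<in> \<Phi>"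
    "Box (BBox B) \<in> \<Phi>" "Box (Neg B) \<in> \<Phi>" "Box (Neg (BBox B)) \<in> \<Phi>"
    using B BBox_mem by (auto simp: \<Phi>_def)
  show ?thesis
  proof (cases "BBox B \<in> x")
    case True
    then have "Neg (BBox B) \<notin> x" using Neg_world x m by blast
    then have "Box (Neg (BBox B)) \<notin> u" using ux by (auto simp: rel_def)
    then have "\<not> GR_bullet (Imp F (Box (Neg (BBox B))))"
      using decides_mem_iff[OF F] m by blast
    moreover have "GR_bullet (Imp F (Box (Neg (BBox B))))" if "GR_bullet (Imp F (Box (Neg B)))"
      using that unfolding GR_bullet_def
      by (rule derivable_taut2[OF _ derivable.Axiom[OF GR_axiom.Dia_BBox_Dia[of B]]])
        (auto simp: tautology_def)
    ultimately obtain z where "z \<in> worlds" "rel u z" "Neg B \<notin> z"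
      using rel_exists[OF F m(7)] by blast
    then show ?thesis using True Neg_world m by blast
  next
    case False
    then have "Box (BBox B) \<notin> u" using ux by (auto simp: rel_def)
    then have "\<not> GR_bullet (Imp F (Box (BBox B)))"
      using decides_mem_iff[OF F] m by blast
    moreover have "GR_bullet (Imp F (Box (BBox B)))" if "GR_bullet (Imp F (Box B))"
      using that unfolding GR_bullet_def
      by (rule derivable_taut2[OF _ derivable.Axiom[OF GR_axiom.Box_Box_BBox[of B]]])
        (auto simp: tautology_def)
    ultimately obtain z where "z \<in> worlds" "rel u z" "B \<notin> z"
      using rel_exists[OF F m(3)] by blast
    then show ?thesis using False by blast
  qed
qed

text \<open>A successor excludes \<open>Box Bot\<close> from \<open>x\<close>; then two of the
  axioms make \<open>Box B\<close> and \<open>BBox B\<close> equivalent there.\<close>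

lemma BBox_world_nonterminal:
  assumes x: "x \<in> worlds" and "y \<in> worlds" "rel x y" and B: "BBox B \<in> \<Gamma>"
  shows "BBox B \<in> x \<longleftrightarrow> Box B \<in> x"
proof -
  obtain F where F: "decides \<Phi> F x" using x by (auto simp: worlds_def)
  note i = decides_mem_iff[OF F] decides_notin_iff[OF F]
  have m: "BBox B \<in> \<Phi>" "Box B \<in> \<Phi>" "Box Bot \<in> \<Phi>"
    using B BBox_mem Bot_mem by (auto simp: \<Phi>_def)
  have "Box Bot \<notin> x"
    using assms Bot_world by (auto simp: rel_def)
  then have nb: "GR_bullet (Imp F (Neg (Box Bot)))" using i m by blast
  have "GR_bullet (Imp F (Box B))" if "GR_bullet (Imp F (BBox B))"
    using that unfolding GR_bullet_def
    by (rule derivable_taut2[OF _ derivable.Axiom[OF GR_axiom.BBox_Box[of B]]])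
      (auto simp: tautology_def)
  moreover have "GR_bullet (Imp F (BBox B))" if "GR_bullet (Imp F (Box B))"
    using that nb unfolding GR_bullet_def
    by (rule derivable_taut3[OF _ _ derivable.Axiom[OF GR_axiom.Box_Bot_BBox[of B]]])
      (auto simp: tautology_def)
  ultimately show ?thesis using i m by blast
qed

section \<open>The frame of chains\<close>

text \<open>Passing to chains turns the order into a tree: a non-empty chain has the unique
  immediate predecessor \<open>butlast p\<close>, to which \<open>S\<close> refers.\<close>

definition W :: "fm set list set" where
  "W = {p. set p \<subseteq> worlds \<and> sorted_wrt rel p}"

definition R :: "fm set list rel" where
  "R = {(p, q). p \<in> W \<and> q \<in> W \<and> (\<exists>r. r \<noteq> [] \<and> q = p @ r)}"

text \<open>All targets from a terminal chain agree on \<open>B\<close>, so the universal clause for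
  \<open>BBox B\<close> gets the right value once a single target exists.\<close>

definition S :: "fm \<Rightarrow> fm set list rel" where
  "S B = R \<union> {(p, q). p \<in> W \<and> (\<forall>q'. (p, q') \<notin> R) \<and> (butlast p, q) \<in> R \<and>
     (BBox B \<in> \<Gamma> \<longrightarrow> (B \<in> last q \<longleftrightarrow> BBox B \<in> last p))}"

text \<open>The root carries no world, so every variable is made false there; the truth lemma leaves
  it out.\<close>

definition V :: "nat \<Rightarrow> fm set list set" where
  "V n = {p \<in> W. p \<noteq> [] \<and> Var n \<in> last p}"

lemma last_worlds: "p \<in> W \<Longrightarrow> p \<noteq> [] \<Longrightarrow> last p \<in> worlds"
  by (auto simp: W_def)

lemma Nil_W: "[] \<in> W"
  by (simp add: W_def)

lemma singleton_W: "x \<in> worlds \<Longrightarrow> [x] \<in> W"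
  by (simp add: W_def)

lemma Nil_R: "p \<in> W \<Longrightarrow> p \<noteq> [] \<Longrightarrow> ([], p) \<in> R"
  by (simp add: R_def Nil_W)

lemma snoc_W:
  assumes "p \<in> W" and "p \<noteq> []" and "y \<in> worlds" and "rel (last p) y"
  shows "p @ [y] \<in> W"
proof -
  obtain q x where p: "p = q @ [x]" using assms(2) by (metis rev_exhaust)
  then show ?thesis
    using assms by (auto simp: W_def sorted_wrt_append intro: rel_trans)
qed

lemma R_snoc:
  assumes "p \<in> W" and "p \<noteq> []" and "y \<in> worlds" and "rel (last p) y"
  shows "(p, p @ [y]) \<in> R"
  using snoc_W[OF assms] assms(1) by (auto simp: R_def)

lemma R_imp_rel:
  assumes "(p, q) \<in> R" and "p \<noteq> []"
  shows "q \<noteq> [] \<and> last q \<in> worlds \<and> rel (last p) (last q)"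
proof -
  obtain r where r: "r \<noteq> []" "q = p @ r" "q \<in> W" using assms by (auto simp: R_def)
  then have "rel (last p) (last r)"
    using assms(2) by (auto simp: W_def sorted_wrt_append)
  then show ?thesis using r last_worlds[of q] by auto
qed

lemma butlast_W: "p \<in> W \<Longrightarrow> butlast p \<in> W"
  by (cases p rule: rev_cases) (auto simp: W_def sorted_wrt_append)

lemma butlast_R: "p \<in> W \<Longrightarrow> p \<noteq> [] \<Longrightarrow> (butlast p, p) \<in> R"
  using butlast_W[of p] by (cases p rule: rev_cases) (auto simp: R_def)

lemma R_trans:
  assumes "(p, q) \<in> R" and "(q, s) \<in> R"
  shows "(p, s) \<in> R"
proof -
  obtain r r' where "r \<noteq> []" "s = p @ (r @ r')" "p \<in> W" "s \<in> W"
    using assms unfolding R_def by auto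
  then show ?thesis
    unfolding R_def by blast
qed

text \<open>The added part is non-empty, so dropping the last element of \<open>q\<close> still
  leaves an extension of \<open>p\<close>, possibly \<open>p\<close> itself.\<close>

lemma R_butlast:
  assumes "(p, q) \<in> R"
  shows "p = butlast q \<or> (p, butlast q) \<in> R"
proof -
  obtain r where r: "r \<noteq> []" "q = p @ r" "p \<in> W" "q \<in> W"
    using assms by (auto simp: R_def)
  then have "butlast q = p @ butlast r"
    by (simp add: butlast_append)
  then show ?thesis
    using butlast_W[OF r(4)] r(3) by (cases "butlast r = []") (auto simp: R_def)
qed

text \<open>Irreflexivity of \<open>rel\<close> makes chains repetition-free, and only finitely many
  worlds exist.\<close>

lemma finite_W: "finite W"
proof (rule finite_subset)
  have "distinct p" if "sorted_wrt rel p" for p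
    using that by (induction p) (auto simp: rel_def)
  then show "W \<subseteq> {p. set p \<subseteq> worlds \<and> distinct p}"
    by (auto simp: W_def)
qed (simp add: finite_subset_distinct finite_worlds)

lemma R_nonterminal_iff:
  assumes "p \<in> W" and "p \<noteq> []"
  shows "(\<exists>q. (p, q) \<in> R) \<longleftrightarrow> (\<exists>y\<in>worlds. rel (last p) y)"
  using R_snoc[OF assms] R_imp_rel[OF _ assms(2)] by blast

lemma worlds_nonempty: "worlds \<noteq> {}"
proof -
  have "\<not> GR_bullet (Neg (Neg Bot))"
  proof
    assume "GR_bullet (Neg (Neg Bot))"
    then have "GR_bullet Bot"
      unfolding GR_bullet_def by (rule derivable_taut1) (auto simp: tautology_def)
    then show False using consistent by blast
  qed
  then show ?thesis
    using decides_exists[OF finite_\<Phi>] unfolding worlds_def by blast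
qed

lemma nontrivial_W: "nontrivial W R"
proof -
  obtain x where "x \<in> worlds" using worlds_nonempty by blast
  then show ?thesis
    unfolding nontrivial_def using Nil_W singleton_W Nil_R by blast
qed

lemma S_terminal_exists:
  assumes p: "p \<in> W" and "\<And>q. (p, q) \<notin> R"
  shows "\<exists>q. (butlast p, q) \<in> R \<and> (BBox B \<in> \<Gamma> \<longrightarrow> (B \<in> last q \<longleftrightarrow> BBox B \<in> last p))"
proof -
  \<comment> \<open>Some world exists, so the root is not terminal.\<close>
  have ne: "p \<noteq> []"
    using assms worlds_nonempty Nil_R singleton_W by blast
  have b: "butlast p \<in> W" "(butlast p, p) \<in> R" using butlast_W butlast_R p ne by blast+
  have lp: "last p \<in> worlds" using last_worlds p ne by blast
  show ?thesis
  proof (cases "BBox B \<in> \<Gamma>")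
    case False
    \<comment> \<open>Nothing is asked about \<open>B\<close>, so \<open>p\<close> itself serves as
      target.\<close>
    then show ?thesis using b by blast
  next
    case B: True
    show ?thesis
    proof (cases "butlast p = []")
      case True
      obtain z where "z \<in> worlds" "B \<in> z \<longleftrightarrow> BBox B \<in> last p"
        using BBox_world_initial[OF lp B] by blast
      then have "(butlast p, [z]) \<in> R \<and> (B \<in> last [z] \<longleftrightarrow> BBox B \<in> last p)"
        using True Nil_R singleton_W by auto
      then show ?thesis by blast
    next
      case False
      then have u: "last (butlast p) \<in> worlds" "rel (last (butlast p)) (last p)"
        using b last_worlds R_imp_rel by blast+
      obtain z where "z \<in> worlds" "rel (last (butlast p)) z" "B \<in> z \<longleftrightarrow> BBox B \<in> last p"
        using BBox_world_successor[OF u(1) lp u(2) B] by blast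
      then have "(butlast p, butlast p @ [z]) \<in> R \<and>
          (B \<in> last (butlast p @ [z]) \<longleftrightarrow> BBox B \<in> last p)"
        using R_snoc b False by auto
      then show ?thesis by blast
    qed
  qed
qed

lemma S_serial:
  assumes "p \<in> W"
  shows "\<exists>q. (p, q) \<in> S B"
  using S_terminal_exists[OF assms, of B] assms by (auto simp: S_def)

text \<open>Condition (ii): a target that is not above \<open>q\<close> is above the predecessor of
  \<open>q\<close>, which is \<open>p\<close> or lies above \<open>p\<close>.\<close>

lemma R_S:
  assumes "(p, q) \<in> R" and "(q, s) \<in> S B"
  shows "(p, s) \<in> R"
proof (cases "(q, s) \<in> R")
  case True
  then show ?thesis using assms R_trans by blast
next
  case False
  then have "(butlast q, s) \<in> R" using assms by (auto simp: S_def)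
  then show ?thesis using R_butlast[OF assms(1)] R_trans by blast
qed

lemma frame_W: "GRo_frame W R S"
proof -
  have RW: "R \<subseteq> W \<times> W" by (auto simp: R_def)
  then have SW: "S B \<subseteq> W \<times> W" for B by (auto simp: S_def)
  have tr: "trans R" using R_trans by (auto intro: transI)
  have "irrefl R" by (auto simp: irrefl_def R_def)
  then have "acyclic R" using tr by (simp add: acyclic_irrefl)
  moreover have "finite R" using RW finite_W by (meson finite_SigmaI finite_subset)
  ultimately have wf: "wf (R\<inverse>)" by (rule finite_acyclic_wf_converse[rotated])
  \<comment> \<open>Condition (iv) follows from seriality, since condition (ii) puts every target of
    \<open>q\<close> above \<open>p\<close>.\<close>
  have ex: "\<exists>s\<in>W. (q, s) \<in> S B \<and> (p, s) \<in> R" if "(p, q) \<in> R" for p q B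
  proof -
    have "q \<in> W" using that RW by blast
    then obtain s where "(q, s) \<in> S B" using S_serial by blast
    then show ?thesis using R_S that SW by blast
  qed
  have RS: "(p, q) \<in> S B" if "(p, q) \<in> R" for B p q
    using that by (simp add: S_def)
  have SR: "(p, q) \<in> R" if "(p, q) \<in> S B" "(p, s) \<in> R" for B p q s
    using that by (auto simp: S_def)
  show ?thesis
    unfolding GRo_frame_def
    by (intro conjI allI ballI impI RW SW tr wf) (use Nil_W RS R_S SR ex in \<open>blast+\<close>)
qed

section \<open>The truth lemma\<close>

lemma Box_chain:
  assumes p: "p \<in> W" "p \<noteq> []" and C: "Box C \<in> \<Phi>"
  shows "Box C \<in> last p \<longleftrightarrow> (\<forall>q. (p, q) \<in> R \<longrightarrow> C \<in> last q)"
proof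
  assume "Box C \<in> last p"
  then show "\<forall>q. (p, q) \<in> R \<longrightarrow> C \<in> last q"
    using R_imp_rel p by (auto simp: rel_def)
next
  assume *: "\<forall>q. (p, q) \<in> R \<longrightarrow> C \<in> last q"
  have "C \<in> y" if "y \<in> worlds" "rel (last p) y" for y
    using * R_snoc[OF p that] by fastforce
  then show "Box C \<in> last p"
    using Box_world[OF last_worlds[OF p] C] by blast
qed

text \<open>At a non-terminal chain both the relations and the formulas \<open>Box B\<close>,
  \<open>BBox B\<close> coincide. At a terminal one all targets agree with \<open>BBox B\<close>,
  and seriality supplies one.\<close>

lemma BBox_chain:
  assumes p: "p \<in> W" "p \<noteq> []" and B: "BBox B \<in> \<Gamma>"
  shows "BBox B \<in> last p \<longleftrightarrow> (\<forall>q. (p, q) \<in> S B \<longrightarrow> B \<in> last q)"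
proof (cases "\<exists>q. (p, q) \<in> R")
  case True
  then have "(p, q) \<in> S B \<longleftrightarrow> (p, q) \<in> R" for q by (auto simp: S_def)
  moreover have "BBox B \<in> last p \<longleftrightarrow> Box B \<in> last p"
    using True BBox_world_nonterminal[OF last_worlds[OF p] _ _ B] R_nonterminal_iff[OF p] by blast
  moreover have "Box B \<in> \<Phi>" using B BBox_mem by (auto simp: \<Phi>_def)
  ultimately show ?thesis using Box_chain[OF p] by simp
next
  case False
  then have "\<forall>q. (p, q) \<in> S B \<longrightarrow> (B \<in> last q \<longleftrightarrow> BBox B \<in> last p)"
    using B by (auto simp: S_def)
  then show ?thesis using S_serial[OF p(1), of B] by blast
qed

text \<open>Successors of non-empty chains under \<open>R\<close> and \<open>S\<close> are
  non-empty, so the induction never meets the root.\<close>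

lemma truth:
  assumes "p \<in> W" and "p \<noteq> []" and "C \<in> \<Gamma>"
  shows "forces R S V p C \<longleftrightarrow> C \<in> last p"
  using assms
proof (induction C arbitrary: p)
  case (Var n)
  then show ?case by (simp add: V_def)
next
  case Bot
  then show ?case using Bot_world last_worlds by simp
next
  case (Neg C)
  then show ?case
    using Neg_world[of "last p" C] last_worlds Neg_mem by (simp add: \<Phi>_def)
next
  case (Or C D)
  then show ?case
    using Or_world[of "last p" C D] last_worlds Or_mem[of C D] by (simp add: \<Phi>_def)
next
  case (Box C)
  have "q \<in> W \<and> q \<noteq> []" if "(p, q) \<in> R" for q
    using that by (auto simp: R_def)
  moreover have "C \<in> \<Gamma>" "Box C \<in> \<Phi>" using Box.prems Box_mem by (auto simp: \<Phi>_def)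
  ultimately show ?case
    using Box.IH Box_chain[OF Box.prems(1,2)] by auto
next
  case (BBox C)
  have "q \<in> W \<and> q \<noteq> []" if "(p, q) \<in> S C" for q
    using that by (auto simp: R_def S_def)
  moreover have "C \<in> \<Gamma>" using BBox.prems BBox_mem by auto
  ultimately show ?case
    using BBox.IH BBox_chain[OF BBox.prems] by auto
qed

text \<open>A world without \<open>A\<close>, taken as a one-element chain, refutes
  \<open>A\<close>; the root sees this chain and so refutes \<open>Box A\<close>.\<close>

lemma refuted:
  assumes A: "A \<in> \<Gamma>" and nA: "\<not> GR_bullet A"
  shows "\<not> valid_on W R S A" and "\<not> valid_on W R S (Box A)"
proof -
  have "\<not> GR_bullet (Neg (Neg A))"
  proof
    assume "GR_bullet (Neg (Neg A))"
    then have "GR_bullet A"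
      unfolding GR_bullet_def by (rule derivable_taut1) (auto simp: tautology_def)
    then show False using nA by blast
  qed
  then obtain G x where G: "GR_bullet (Imp G (Neg A))" "decides \<Phi> G x"
    using decides_exists finite_\<Phi> by blast
  then have x: "x \<in> worlds" "A \<notin> x"
    using A decides_notin_iff[OF G(2), of A] by (auto simp: worlds_def \<Phi>_def)
  then have xW: "[x] \<in> W" using singleton_W by blast
  then have nf: "\<not> forces R S V [x] A" using truth[of "[x]"] x A by simp
  have V: "\<forall>n. V n \<subseteq> W" by (auto simp: V_def)
  show "\<not> valid_on W R S A"
    using nf V xW by (auto simp: valid_on_def)
  have "([], [x]) \<in> R" using Nil_R xW by blast
  then have "\<not> forces R S V [] (Box A)" using nf by auto
  then show "\<not> valid_on W R S (Box A)"
    using V Nil_W by (auto simp: valid_on_def)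
qed

end

section \<open>From the chain model to the equivalences\<close>

fun subformulas :: "fm \<Rightarrow> fm set" where
  "subformulas (Var n) = {Var n}"
| "subformulas Bot = {Bot}"
| "subformulas (Neg A) = insert (Neg A) (subformulas A)"
| "subformulas (Or A B) = insert (Or A B) (subformulas A \<union> subformulas B)"
| "subformulas (Box A) = insert (Box A) (subformulas A)"
| "subformulas (BBox A) = insert (BBox A) (subformulas A)"

lemma finite_subformulas: "finite (subformulas A)"
  by (induction A) auto

lemma subformulas_refl: "A \<in> subformulas A"
  by (cases A) auto

lemma subformulas_trans: "B \<in> subformulas A \<Longrightarrow> subformulas B \<subseteq> subformulas A"
  by (induction A) auto

lemma chain_model_subformulas:
  assumes "\<not> GR_bullet A"
  shows "chain_model (insert Bot (subformulas A))"
proof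
  show "\<not> GR_bullet Bot"
  proof
    assume "GR_bullet Bot"
    then have "GR_bullet A"
      unfolding GR_bullet_def by (rule derivable_taut1) (auto simp: tautology_def)
    then show False using assms by blast
  qed
qed (use finite_subformulas subformulas_trans subformulas_refl in fastforce)+

lemma GR_bullet_countermodel:
  assumes "\<not> GR_bullet A"
  obtains W :: "fm set list set" and R S where "finite W" "GRo_frame W R S" "nontrivial W R"
    "\<not> valid_on W R S A" "\<not> valid_on W R S (Box A)"
proof -
  interpret chain_model "insert Bot (subformulas A)"
    using assms by (rule chain_model_subformulas)
  show thesis
    using that finite_W frame_W nontrivial_W refuted[OF _ assms] subformulas_refl by blast
qed

text \<open>The countermodel to \<open>A\<close> refutes \<open>Box A\<close> at its root, and
  non-triviality makes it serial, so soundness applies.\<close>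

lemma GR_bullet_if_Box:
  assumes "GR_bullet (Box A)"
  shows "GR_bullet A"
proof (rule ccontr)
  assume "\<not> GR_bullet A"
  then obtain W :: "fm set list set" and R S where
    "GRo_frame W R S" "nontrivial W R" "\<not> valid_on W R S (Box A)"
    using GR_bullet_countermodel by metis
  then show False
    using GR_bullet_sound[OF assms] nontrivial_imp_BBox_serial by blast
qed

lemma GR_imp_GR_bullet:
  assumes "GR A"
  shows "GR_bullet A"
  using assms unfolding GR_def
proof (induction rule: derivable.induct)
  case (Extra A B)
  then show ?case
    by (auto simp: Box_elim_rule_def intro: GR_bullet_if_Box)
qed (auto simp: GR_bullet_def intro: derivable.intros)

text \<open>The countermodel is finite, so any infinite type has a subset of the same size to carry
  an isomorphic copy.\<close>

lemma GR_bullet_complete: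
  assumes "infinite (UNIV :: 'w set)"
    and val: "\<forall>(W :: 'w set) R S. GRo_frame W R S \<and> nontrivial W R \<longrightarrow> valid_on W R S A"
  shows "GR_bullet A"
proof (rule ccontr)
  assume "\<not> GR_bullet A"
  then obtain W :: "fm set list set" and R S where
    W: "finite W" "GRo_frame W R S" "nontrivial W R" "\<not> valid_on W R S A"
    using GR_bullet_countermodel by metis
  obtain W' :: "'w set" where "finite W'" "card W' = card W"
    using infinite_arbitrarily_large[OF assms(1)] by blast
  then obtain g where g: "bij_betw g W' W"
    using W(1) finite_same_card_bij by blast
  then show False
    using val GRo_frame_pull[OF W(2) g] nontrivial_pull[OF W(3) g] valid_on_pull[OF W(2) g] W(4)
    by blast
qed

theorem theorem5p5:
  fixes A :: fm
  assumes "infinite (UNIV :: 'w set)"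
  shows "(GR_bullet A \<longleftrightarrow> GR A) \<and>
    (GR A \<longleftrightarrow>
      (\<forall>(W :: 'w set) R S. GRo_frame W R S \<and> nontrivial W R \<longrightarrow> valid_on W R S A)) \<and>
    ((\<forall>(W :: 'w set) R S. GRo_frame W R S \<and> nontrivial W R \<longrightarrow> valid_on W R S A) \<longleftrightarrow>
      (\<forall>(W :: 'w set) R S. GRo_frame W R S \<and> BBox_serial W S \<longrightarrow> valid_on W R S A))"
    (is "_ \<and> (_ \<longleftrightarrow> ?N) \<and> (_ \<longleftrightarrow> ?S)")
proof -
  have "GR_bullet A \<longleftrightarrow> GR A"
    using GR_bullet_imp_GR GR_imp_GR_bullet by blast
  moreover have "GR_bullet A \<Longrightarrow> ?S"
    using GR_bullet_sound by blast
  moreover have "?S \<Longrightarrow> ?N"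
    using nontrivial_imp_BBox_serial by blast
  moreover have "?N \<Longrightarrow> GR_bullet A"
    using GR_bullet_complete[OF assms] .
  ultimately show ?thesis by blast
qed

end
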